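(* Let $k\ge 1$. A connected graph $G$ is well-hued with sequence $(2,4,6,\dots,2k,2k+1)$ if and only if $G$ is formed in the following way: (1) $G$ is obtained from a vertex $c$ together with a graph $G_1$ of order $2k$ (so $V(G)=V(G_1)\cup\{c\}$ and $G_1=G-c$), where $G_1$ is a spanning subgraph of the complete $k$-partite graph $K_{2,\dots,2}$ (with $k$ partite sets of size $2$) and $\alpha(G_1)=2$; (2) the set $S=V(G_1)-N_G[c]$ is nonempty and is an independent $\mathcal{M}$-alternating dominating set in $\overline{G_1}$, where $\mathcal{M}$ is the perfect matching of $\overline{G_1}$ whose edges are the $k$ partite sets of $K_{2,\dots,2}$.
   Context: All graphs are finite and simple. For $j\ge 1$, a maximal $j$-colorable subgraph of $G$ is a subgraph induced by a set $S\subseteq V(G)$ such that $G[S]$ is (properly) $j$-colorable and $G[S']$ is not $j$-colorable for every $S'$ with $S\subsetneq S'\subseteq V(G)$. $G$ is well-hued if for every $j\ge 1$ all maximal $j$-colorable subgraphs of $G$ have the same order, denoted $a_j$. The sequence of a well-hued graph $G$ is written $(a_1,a_2,\dots,a_{\chi(G)})$, where $a_{\chi(G)}=|V(G)|$. $\overline{H}$ is the complement of $H$, $\alpha$ the independence number, $N_G[c]$ the closed neighborhood. Given a matching $\mathcal{M}$ in a graph $H$, a path $P$ in $H$ is an $(\mathcal{M},E(H)-\mathcal{M})$-alternating path if no two consecutive edges of $P$ are both in $\mathcal{M}$ and no two consecutive edges are both in $E(H)-\mathcal{M}$. If $\mathcal{M}$ is a perfect matching of $H$, a set $S\subseteq V(H)$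 is an $\mathcal{M}$-alternating dominating set of $H$ if every vertex $v\in V(H)$ is either in $S$ or lies on an $(\mathcal{M},E(H)-\mathcal{M})$-alternating path that originates at some vertex $u\in S$ and begins with the edge of $\mathcal{M}$ incident to $u$. It is independent if no two vertices of $S$ are adjacent in $H$. *)

theory Defs
  imports "Graph_Theory.Graph_Theory" "HOL-Library.Disjoint_Sets"
begin

(* Undirected graphs are symmetric loop-free digraphs: an undirected edge {u,v} is the pair of
   arcs (u,v), (v,u), and adjacency is the relation \<open>u \<rightarrow>\<^bsub>G\<^esub> v\<close>. *)

definition edges :: "('a, 'b) pre_digraph \<Rightarrow> 'a set set" where
  "edges G = {{u, v} | u v. u \<rightarrow>\<^bsub>G\<^esub> v}"

definition complement :: "('a, 'b) pre_digraph \<Rightarrow> 'a pair_pre_digraph" where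
  "complement G = \<lparr> pverts = verts G,
     parcs = {(u, v). u \<in> verts G \<and> v \<in> verts G \<and> u \<noteq> v \<and> \<not> u \<rightarrow>\<^bsub>G\<^esub> v} \<rparr>"

definition closed_neighborhood :: "('a, 'b) pre_digraph \<Rightarrow> 'a \<Rightarrow> 'a set" where
  "closed_neighborhood G c = insert c {v. c \<rightarrow>\<^bsub>G\<^esub> v}"

definition independent_set :: "('a, 'b) pre_digraph \<Rightarrow> 'a set \<Rightarrow> bool" where
  "independent_set G S \<longleftrightarrow> S \<subseteq> verts G \<and> (\<forall>u\<in>S. \<forall>v\<in>S. \<not> u \<rightarrow>\<^bsub>G\<^esub> v)"

definition independence_number :: "('a, 'b) pre_digraph \<Rightarrow> nat" where
  "independence_number G = Max (card ` {S. independent_set G S})"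

definition complete_multipartite :: "'a set set \<Rightarrow> 'a pair_pre_digraph" where
  "complete_multipartite P = \<lparr> pverts = \<Union>P,
     parcs = {(u, v). \<exists>A\<in>P. \<exists>B\<in>P. A \<noteq> B \<and> u \<in> A \<and> v \<in> B} \<rparr>"

definition colorable :: "('a, 'b) pre_digraph \<Rightarrow> nat \<Rightarrow> bool" where
  "colorable G j \<longleftrightarrow>
     (\<exists>f :: 'a \<Rightarrow> nat. (\<forall>v\<in>verts G. f v < j) \<and> (\<forall>u v. u \<rightarrow>\<^bsub>G\<^esub> v \<longrightarrow> f u \<noteq> f v))"

definition chromatic_number :: "('a, 'b) pre_digraph \<Rightarrow> nat" where
  "chromatic_number G = (LEAST j. colorable G j)"

definition maximal_colorable :: "('a, 'b) pre_digraph \<Rightarrow> nat \<Rightarrow> 'a set \<Rightarrow> bool" where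
  "maximal_colorable G j S \<longleftrightarrow> S \<subseteq> verts G \<and> colorable (G \<restriction> S) j \<and>
     (\<forall>S'. S \<subset> S' \<and> S' \<subseteq> verts G \<longrightarrow> \<not> colorable (G \<restriction> S') j)"

definition well_hued :: "('a, 'b) pre_digraph \<Rightarrow> bool" where
  "well_hued G \<longleftrightarrow>
     (\<forall>j\<ge>1. \<forall>S T. maximal_colorable G j S \<and> maximal_colorable G j T \<longrightarrow> card S = card T)"

(* The number a_j; meaningful for well-hued graphs only. *)
definition hue_number :: "('a, 'b) pre_digraph \<Rightarrow> nat \<Rightarrow> nat" where
  "hue_number G j = (THE n. \<exists>S. maximal_colorable G j S \<and> card S = n)"

definition hue_sequence :: "('a, 'b) pre_digraph \<Rightarrow> nat list" where
  "hue_sequence G = map (hue_number G) [1..<Suc (chromatic_number G)]"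

definition matching :: "('a, 'b) pre_digraph \<Rightarrow> 'a set set \<Rightarrow> bool" where
  "matching H M \<longleftrightarrow> M \<subseteq> edges H \<and> disjoint M"

definition perfect_matching :: "('a, 'b) pre_digraph \<Rightarrow> 'a set set \<Rightarrow> bool" where
  "perfect_matching H M \<longleftrightarrow> matching H M \<and> \<Union>M = verts H"

definition path_edges :: "'a list \<Rightarrow> 'a set list" where
  "path_edges p = map (\<lambda>(u, v). {u, v}) (vwalk_arcs p)"

definition alternating_path :: "('a, 'b) pre_digraph \<Rightarrow> 'a set set \<Rightarrow> 'a list \<Rightarrow> bool" where
  "alternating_path H M p \<longleftrightarrow> vpath p H \<and>
     successively (\<lambda>e f. \<not> (e \<in> M \<and> f \<in> M) \<and> \<not> (e \<in> edges H - M \<and> f \<in> edges H - M))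
       (path_edges p)"

(* A path p originates at its first vertex hd p, so hd (path_edges p) is incident to hd p. *)
definition alternating_dominating_set ::
    "('a, 'b) pre_digraph \<Rightarrow> 'a set set \<Rightarrow> 'a set \<Rightarrow> bool" where
  "alternating_dominating_set H M S \<longleftrightarrow> perfect_matching H M \<and> S \<subseteq> verts H \<and>
     (\<forall>v\<in>verts H. v \<in> S \<or>
       (\<exists>p. alternating_path H M p \<and> v \<in> set p \<and> hd p \<in> S \<and>
            path_edges p \<noteq> [] \<and> hd (path_edges p) \<in> M))"

end

theory Submission
  imports Defs
begin

text \<open>Let \<open>H\<close> be the complement of \<open>G\<close>. Independent sets of size at most 2 in \<open>G\<close> are vertices and
  edges of \<open>H\<close>, so with \<open>H\<close> triangle-free a set \<open>S\<close> is \<open>j\<close>-colorable in \<open>G\<close> iff \<open>H[S]\<close> has a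
  matching that covers at least \<open>2|S| - 2j\<close> vertices, and the theorem becomes a statement about
  matchings of \<open>H\<close>. Let \<open>D\<close> be the set of vertices \<open>d\<close>
  for which \<open>H - d\<close> has a perfect matching. Shifting the matching along an alternating path from \<open>c\<close>
  shows that the domination condition makes every vertex lie in \<open>D\<close> or have a neighbor in \<open>D\<close>.
  This is just what is needed to enlarge, by one vertex at a time, a set that is perfectly matched
  up to one vertex. Conversely, alternating paths from \<open>c\<close> are found in the symmetric difference
  of two matchings that miss one vertex each.\<close>

subsection \<open>Perfect matchings as involutions\<close>

text \<open>A perfect matching of \<open>W\<close> in the graph \<open>R\<close>, encoded as an
  involution that sends each vertex to its partner. There are no fixed points once \<open>R\<close>
  is irreflexive, and values outside \<open>W\<close> are arbitrary.\<close>

definition pairing :: "('a \<Rightarrow> 'a \<Rightarrow> bool) \<Rightarrow> 'a set \<Rightarrow> ('a \<Rightarrow> 'a) \<Rightarrow> bool" where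
  "pairing R W f \<longleftrightarrow> (\<forall>v\<in>W. f v \<in> W \<and> f (f v) = v \<and> R v (f v))"

definition pairable :: "('a \<Rightarrow> 'a \<Rightarrow> bool) \<Rightarrow> 'a set \<Rightarrow> bool" where
  "pairable R W \<longleftrightarrow> (\<exists>f. pairing R W f)"

lemma pairing_subset:
  assumes "pairing R W f" "A \<subseteq> W" "\<And>v. v \<in> A \<Longrightarrow> f v \<in> A"
  shows "pairing R A f"
  using assms unfolding pairing_def by blast

lemma pairing_Diff:
  assumes "pairing R W f" "\<And>v. v \<in> A \<Longrightarrow> f v \<in> A"
  shows "pairing R (W - A) f"
  using assms unfolding pairing_def by (metis DiffD1 DiffD2 DiffI)

lemma pairing_Un:
  assumes "pairing R A f" "pairing R B g" "A \<inter> B = {}"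
  shows "pairing R (A \<union> B) (\<lambda>v. if v \<in> A then f v else g v)"
  using assms unfolding pairing_def by auto

lemma pairable_Un:
  assumes "pairable R A" "pairable R B" "A \<inter> B = {}"
  shows "pairable R (A \<union> B)"
  using assms pairing_Un unfolding pairable_def by blast

lemma pairable_edge:
  assumes "R u v" "R v u"
  shows "pairable R {u, v}"
  unfolding pairable_def pairing_def
  using assms by (intro exI[of _ "\<lambda>x. if x = u then v else u"]) auto

lemma card_pairing_edges:
  assumes "finite W" "pairing R W f" "irreflp R"
  shows "card ((\<lambda>v. {v, f v}) ` W) * 2 = card W"
proof -
  have f: "f v \<in> W" "f (f v) = v" "f v \<noteq> v" if "v \<in> W" for v
    using assms that unfolding pairing_def irreflp_def by metis+
  have "2 * card ((\<lambda>v. {v, f v}) ` W) = card (\<Union> ((\<lambda>v. {v, f v}) ` W))"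
  proof (rule card_partition)
    show "finite ((\<lambda>v. {v, f v}) ` W)" "finite (\<Union> ((\<lambda>v. {v, f v}) ` W))"
      using assms(1) by auto
    show "card c = 2" if "c \<in> (\<lambda>v. {v, f v}) ` W" for c
      using that f by (auto simp: card_insert_if) metis
    show "c1 \<inter> c2 = {}"
      if "c1 \<in> (\<lambda>v. {v, f v}) ` W" "c2 \<in> (\<lambda>v. {v, f v}) ` W" "c1 \<noteq> c2" for c1 c2
      using that f by auto (metis f(2))+
  qed
  moreover have "\<Union> ((\<lambda>v. {v, f v}) ` W) = W" using f by auto
  ultimately show ?thesis by simp
qed

subsection \<open>Alternating paths\<close>

text \<open>The list is the path without its start \<open>c\<close>, which is the vertex missed by \<open>f\<close>.\<close>

inductive alternating :: "('a \<Rightarrow> 'a \<Rightarrow> bool) \<Rightarrow> ('a \<Rightarrow> 'a) \<Rightarrow> 'a \<Rightarrow> 'a set \<Rightarrow> 'a list \<Rightarrow> bool"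
  for R f c T where
  Nil: "alternating R f c T []"
| snoc: "alternating R f c T p \<Longrightarrow> R (last (c # p)) w \<Longrightarrow> w \<in> T - set (c # p) \<Longrightarrow>
    alternating R f c T (p @ [w, f w])"

lemma alternating_props:
  assumes "alternating R f c T p" "pairing R (T - {c}) f" "irreflp R"
  shows "set p \<subseteq> T - {c}" "distinct p" "\<And>v. v \<in> set p \<Longrightarrow> f v \<in> set p"
proof -
  have *: "set p \<subseteq> T - {c} \<and> distinct p \<and> (\<forall>v\<in>set p. f v \<in> set p)"
    using assms(1)
  proof (induction rule: alternating.induct)
    case (snoc p w)
    have f: "f v \<in> T - {c}" "f (f v) = v" "f v \<noteq> v" if "v \<in> T - {c}" for v
      using assms(2,3) that unfolding pairing_def irreflp_def by metis+
    have w: "w \<in> T - {c}" "w \<notin> set p" using snoc.hyps by auto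
    have fw: "f w \<notin> set p" using snoc.IH f(2)[OF w(1)] w(2) by metis
    show ?case using snoc.IH w(1) fw w(2) f[OF w(1)] by auto
  qed simp
  show "set p \<subseteq> T - {c}" "distinct p" using * by auto
  show "f v \<in> set p" if "v \<in> set p" for v using * that by auto
qed

text \<open>Walk from the vertex missed by \<open>n\<close>, using \<open>m\<close> and \<open>n\<close> in turn: the visited set is
  closed under \<open>n\<close>, and under \<open>m\<close> up to its last vertex, so an extension never meets the path
  again. The walk can therefore only stop where \<open>m\<close> is undefined or leads out of \<open>T\<close>.\<close>

lemma symmetric_difference_path:
  assumes "finite T" "T \<subseteq> V" "t \<in> T" "pairing R (T - {t}) n" "pairing R (V - {d}) m"
    and "irreflp R"
  obtains p where "alternating R n t T p"
    "last (t # p) = d \<or> m (last (t # p)) \<notin> T"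
    "\<And>v. v \<in> set (t # p) - {last (t # p)} \<Longrightarrow> v \<noteq> d \<and> m v \<in> set (t # p) - {last (t # p)}"
proof -
  define good where "good p \<longleftrightarrow> alternating R n t T p \<and>
    (\<forall>v \<in> set (t # p) - {last (t # p)}. v \<noteq> d \<and> m v \<in> set (t # p) - {last (t # p)})" for p
  note props = alternating_props[OF _ assms(4,6)]
  have "\<exists>p. good p \<and> (\<forall>q. good q \<longrightarrow> length q \<le> length p)"
  \<comment> \<open>A longest \<open>good\<close> path exists because its vertices are distinct
    elements of the finite set \<open>T\<close>.\<close>
  proof (rule ex_has_greatest_nat[of good "[]" length "Suc (card T)"])
    show "good []" by (simp add: good_def alternating.Nil)
    show "\<forall>q. good q \<longrightarrow> length q < Suc (card T)"
    proof (intro allI impI)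
      fix q assume "good q"
      then have q: "alternating R n t T q" by (simp add: good_def)
      have "set q \<subseteq> T" using props(1)[OF q] by blast
      then show "length q < Suc (card T)"
        unfolding less_Suc_eq_le
        using card_mono[OF assms(1)] distinct_card[OF props(2)[OF q]] by metis
    qed
  qed
  then obtain p where p: "good p" and max: "\<And>q. good q \<Longrightarrow> length q \<le> length p" by blast
  define e where "e = last (t # p)"
  define A where "A = set (t # p) - {e}"
  have alt: "alternating R n t T p" and A: "\<And>v. v \<in> A \<Longrightarrow> v \<noteq> d \<and> m v \<in> A"
    using p unfolding good_def A_def e_def by auto
  have e: "e \<in> set (t # p)" unfolding e_def by (rule last_in_set) simp
  have sub: "set (t # p) \<subseteq> T" using props(1)[OF alt] assms(3) by auto
  have "e = d \<or> m e \<notin> T"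
  proof (rule ccontr)
    assume *: "\<not> (e = d \<or> m e \<notin> T)"
    then have "e \<in> V - {d}" using e sub assms(2) by auto
    then have m: "m (m e) = e" "R e (m e)" "m e \<noteq> e"
      using assms(5,6) unfolding pairing_def irreflp_def by metis+
    \<comment> \<open>Since \<open>m\<close> maps \<open>A\<close> to itself, \<open>m e\<close> in
      \<open>A\<close> would put \<open>m (m e) = e\<close> in \<open>A\<close>.\<close>
    have mA: "m e \<notin> A" using A[of "m e"] m(1) by (auto simp: A_def)
    then have w: "m e \<in> T - set (t # p)" using * m(3) by (auto simp: A_def)
    let ?w = "m e"
    have "?w \<in> T - {t}" using w by simp
    then have n: "n ?w \<in> T" "n (n ?w) = ?w" "n ?w \<noteq> ?w"
      using assms(4,6) unfolding pairing_def irreflp_def by (metis DiffD1)+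
    have nw: "n ?w \<notin> set p"
      using props(3)[OF alt, of "n ?w"] n(2) w by auto
    have nt: "n ?w \<noteq> t" using assms(4) w unfolding pairing_def by auto
    have "alternating R n t T (p @ [?w, n ?w])"
      using alternating.snoc[OF alt _ w] m(2) unfolding e_def by blast
    moreover have "set (t # p @ [?w, n ?w]) - {last (t # p @ [?w, n ?w])} = A \<union> {e, ?w}"
      using nw nt n(3) e unfolding A_def by auto
    moreover have "?w \<noteq> d"
      using assms(5) \<open>e \<in> V - {d}\<close> unfolding pairing_def by auto
    ultimately have "good (p @ [?w, n ?w])"
      unfolding good_def using A m(1) * by (metis Un_iff insertE insert_iff singletonD)
    from max[OF this] show False by simp
  qed
  then show ?thesis using that[OF alt] A unfolding A_def e_def by blast
qed

text \<open>On the path from \<open>t\<close>, the matching \<open>n\<close> of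
  \<open>T - {t}\<close> is replaced by the matching \<open>m\<close> of \<open>V - {d}\<close>; off
  the path \<open>n\<close> stays. If the path ends at \<open>d\<close>, this uncovers
  \<open>d\<close> instead of \<open>t\<close>. Otherwise \<open>m\<close> matches its end to some
  \<open>z\<close> outside \<open>T\<close>, and all of \<open>insert z T\<close> is
  covered.\<close>

lemma exchange:
  assumes "finite T" "T \<subseteq> V" "t \<in> T" "pairable R (T - {t})" "d \<in> V" "pairable R (V - {d})"
    and "irreflp R"
  shows "d \<in> T \<and> pairable R (T - {d}) \<or> (\<exists>z\<in>V - T. pairable R (insert z T))"
proof -
  obtain n m where n: "pairing R (T - {t}) n" and m: "pairing R (V - {d}) m"
    using assms(4,6) unfolding pairable_def by blast
  obtain p where p: "alternating R n t T p" and e: "last (t # p) = d \<or> m (last (t # p)) \<notin> T"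
    and closed: "\<And>v. v \<in> set (t # p) - {last (t # p)} \<Longrightarrow>
      v \<noteq> d \<and> m v \<in> set (t # p) - {last (t # p)}"
    using symmetric_difference_path[OF assms(1-3) n m assms(7)] by blast
  define e where "e = last (t # p)"
  note props = alternating_props[OF p n assms(7)]
  have eQ: "e \<in> set (t # p)" unfolding e_def by (rule last_in_set) simp
  have Q: "set (t # p) \<subseteq> T" using props(1) assms(3) by auto
  have rest: "pairable R (T - set (t # p))"
  proof -
    have "pairing R (T - {t} - set p) n" by (rule pairing_Diff[OF n]) (rule props(3))
    moreover have "T - {t} - set p = T - set (t # p)" by auto
    ultimately show ?thesis unfolding pairable_def by metis
  qed
  show ?thesis
  proof (cases "e = d")
    case True
    have "pairing R (set (t # p) - {e}) m"
    proof (rule pairing_subset[OF m])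
      show "set (t # p) - {e} \<subseteq> V - {d}"
        using Q assms(2) unfolding True by auto
      show "m v \<in> set (t # p) - {e}" if "v \<in> set (t # p) - {e}" for v
        using closed that unfolding e_def by blast
    qed
    then have "pairable R ((set (t # p) - {e}) \<union> (T - set (t # p)))"
      using rest by (intro pairable_Un) (auto simp: pairable_def)
    moreover have "(set (t # p) - {e}) \<union> (T - set (t # p)) = T - {e}" using eQ Q by auto
    ultimately show ?thesis using True eQ Q by auto
  next
    case False
    define z where "z = m e"
    have ev: "e \<in> V - {d}" using False eQ Q assms(2) by auto
    then have z: "z \<in> V - {d}" "m z = e" using m unfolding pairing_def z_def by auto
    have zT: "z \<notin> T" using e False unfolding z_def e_def by blast
    have "pairing R (insert z (set (t # p))) m"
    proof (rule pairing_subset[OF m])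
      show "insert z (set (t # p)) \<subseteq> V - {d}"
      proof -
        have "v \<in> V - {d}" if "v \<in> set (t # p)" for v
        proof (cases "v = e")
          case False
          then show ?thesis using closed[of v] that Q assms(2) unfolding e_def by blast
        qed (use ev in simp)
        then show ?thesis using z(1) by blast
      qed
      show "m v \<in> insert z (set (t # p))" if v: "v \<in> insert z (set (t # p))" for v
      proof -
        consider "v = z" | "v = e" | "v \<in> set (t # p) - {e}" using v by blast
        then show ?thesis
        proof cases
          case 3
          then show ?thesis using closed unfolding e_def by blast
        qed (use z(2) eQ in \<open>simp_all add: z_def\<close>)
      qed
    qed
    then have "pairable R (insert z (set (t # p)) \<union> (T - set (t # p)))"
      using rest zT by (intro pairable_Un) (auto simp: pairable_def)
    moreover have "insert z (set (t # p)) \<union> (T - set (t # p)) = insert z T" using Q by auto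
    ultimately show ?thesis using z(1) zT by auto
  qed
qed

text \<open>Take \<open>v\<close> outside \<open>T\<close> with \<open>d\<close> as in the last hypothesis. Unless \<open>exchange\<close> already extends
  \<open>T\<close>, it moves the uncovered vertex of \<open>T\<close> from \<open>t\<close> to \<open>d\<close>, and then the edge \<open>dv\<close> extends \<open>T\<close>.\<close>

lemma pairable_extend:
  assumes "finite V" "T \<subset> V" "t \<in> T" "pairable R (T - {t})" "irreflp R" "symp R"
    and dom: "\<And>v. v \<in> V \<Longrightarrow> \<exists>d\<in>V. pairable R (V - {d}) \<and> (v = d \<or> R d v)"
  obtains z where "z \<in> V - T" "pairable R (insert z T)"
proof -
  obtain v where v: "v \<in> V - T" using assms(2) by blast
  obtain d where d: "d \<in> V" "pairable R (V - {d})" "v = d \<or> R d v" using dom v by blast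
  have "finite T" "T \<subseteq> V" using assms(1,2) finite_subset by auto
  from exchange[OF this assms(3,4) d(1,2) assms(5)]
  consider "d \<in> T" "pairable R (T - {d})" | z where "z \<in> V - T" "pairable R (insert z T)"
    by blast
  then show ?thesis
  proof cases
    case 1
    then have "R d v" using d(3) v by auto
    then have "pairable R {d, v}" using pairable_edge assms(6) by (metis sympD)
    then have "pairable R ((T - {d}) \<union> {d, v})" using 1 v by (intro pairable_Un) auto
    moreover have "(T - {d}) \<union> {d, v} = insert v T" using 1(1) by auto
    ultimately show ?thesis using that v by simp
  qed (use that in blast)
qed

text \<open>Each step trades the matching edge \<open>{w, f w}\<close> for the edge from the
  uncovered vertex to \<open>w\<close>, so \<open>f w\<close> is uncovered next. Agreement of
  \<open>g\<close> with \<open>f\<close> off the path is carried along so that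
  \<open>{w, f w}\<close> is still a matching edge when the path reaches \<open>w\<close>.\<close>

lemma alternating_pairing:
  assumes "alternating R f c V p" "pairing R (V - {c}) f" "irreflp R" "symp R" "c \<in> V"
  shows "\<exists>g. pairing R (V - {last (c # p)}) g \<and> (\<forall>v\<in>V - set (c # p). g v = f v)"
  using assms(1)
proof (induction rule: alternating.induct)
  case Nil
  then show ?case using assms(2) by auto
next
  case (snoc p w)
  define e where "e = last (c # p)"
  note props = alternating_props[OF snoc.hyps(1) assms(2,3)]
  have eQ: "e \<in> set (c # p)" unfolding e_def by (rule last_in_set) simp
  obtain g where g: "pairing R (V - {e}) g" and gf: "\<And>v. v\<in>V - set (c # p) \<Longrightarrow> g v = f v"
    using snoc.IH unfolding e_def by blast
  have eV: "e \<in> V" using eQ props(1) assms(5) by auto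
  have w: "w \<in> V - {e}" "w \<in> V - set (c # p)" "g w = f w" using snoc.hyps(3) gf eQ by auto
  have gw: "g w \<in> V - {e}" "g (g w) = w" "g w \<noteq> w"
    using g w(1) assms(3) unfolding pairing_def irreflp_def by metis+
  have ew: "R e w" using snoc.hyps(2) unfolding e_def by simp
  have "pairing R (V - {e} - {w, g w}) g"
    by (rule pairing_Diff[OF g]) (use gw in auto)
  moreover have "pairing R {e, w} (\<lambda>v. if v = e then w else e)"
    using ew assms(4) w(1) unfolding pairing_def by (auto dest: sympD)
  ultimately have "pairing R ((V - {e} - {w, g w}) \<union> {e, w})
    (\<lambda>v. if v \<in> V - {e} - {w, g w} then g v else if v = e then w else e)" (is "pairing R _ ?h")
    by (intro pairing_Un) auto
  moreover have "(V - {e} - {w, g w}) \<union> {e, w} = V - {g w}" using w(1) gw eV by auto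
  moreover have "last (c # p @ [w, f w]) = g w" using w(3) by simp
  moreover have "?h v = f v" if "v \<in> V - set (c # p @ [w, f w])" for v
    using that gf[of v] w(3) eQ by auto
  ultimately show ?case by (intro exI[of _ ?h]) simp
qed

subsection \<open>Covers by vertices and edges\<close>

text \<open>The classes of \<open>f\<close> are cliques, some possibly empty, so this is proper
  \<open>j\<close>-colorability seen from the complement.\<close>

definition clique_coverable :: "('a \<Rightarrow> 'a \<Rightarrow> bool) \<Rightarrow> 'a set \<Rightarrow> nat \<Rightarrow> bool" where
  "clique_coverable R S j \<longleftrightarrow> (\<exists>f :: 'a \<Rightarrow> nat. (\<forall>v\<in>S. f v < j) \<and>
     (\<forall>u\<in>S. \<forall>v\<in>S. u \<noteq> v \<and> f u = f v \<longrightarrow> R u v))"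

definition triangle_free :: "('a \<Rightarrow> 'a \<Rightarrow> bool) \<Rightarrow> 'a set \<Rightarrow> bool" where
  "triangle_free R V \<longleftrightarrow> (\<forall>u\<in>V. \<forall>v\<in>V. \<forall>w\<in>V. \<not> (R u v \<and> R v w \<and> R u w))"

text \<open>The matching edges on \<open>W\<close> and the single vertices of \<open>S - W\<close>
  amount to \<open>card S - card W / 2\<close> cliques.\<close>

lemma clique_coverable_if_pairable:
  assumes "finite S" "W \<subseteq> S" "pairable R W" "irreflp R" "2 * card S \<le> 2 * j + card W"
  shows "clique_coverable R S j"
proof -
  obtain f where f: "pairing R W f" using assms(3) unfolding pairable_def by blast
  \<comment> \<open>\<open>h v\<close> is the clique that contains \<open>v\<close>; numbering the
    distinct cliques by \<open>g\<close> gives the colors.\<close>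
  define h where "h v = (if v \<in> W then {v, f v} else {v})" for v
  have W: "finite W" using assms(1,2) finite_subset by auto
  have "h ` S = (\<lambda>v. {v, f v}) ` W \<union> (\<lambda>v. {v}) ` (S - W)"
    using assms(2) unfolding h_def by force
  then have "card (h ` S) \<le> card ((\<lambda>v. {v, f v}) ` W) + card ((\<lambda>v. {v}) ` (S - W))"
    by (simp add: card_Un_le)
  also have "card ((\<lambda>v. {v}) ` (S - W)) = card S - card W"
    using card_Diff_subset[OF W assms(2)] by (simp add: card_image)
  finally have "card (h ` S) \<le> j"
    using card_pairing_edges[OF W f assms(4)] assms(5) card_mono[OF assms(1,2)] by linarith
  moreover obtain g where g: "bij_betw g (h ` S) {0..<card (h ` S)}"
    using ex_bij_betw_finite_nat[of "h ` S"] assms(1) by auto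
  ultimately have "g (h v) < j" if "v \<in> S" for v
    using that bij_betw_apply[OF g] by fastforce
  moreover have "R u v" if "u \<in> S" "v \<in> S" "u \<noteq> v" "g (h u) = g (h v)" for u v
  proof -
    have "h u = h v" using that g by (meson bij_betw_imp_inj_on imageI inj_onD)
    then have "u \<in> W" "v = f u"
      using that(3) unfolding h_def by (auto split: if_splits simp: doubleton_eq_iff)
    then show ?thesis using f unfolding pairing_def by auto
  qed
  ultimately show ?thesis unfolding clique_coverable_def by (intro exI[of _ "\<lambda>v. g (h v)"]) blast
qed

text \<open>Triangle-freeness limits the classes to two vertices. Those with two form a matching of
  \<open>W\<close>, the others are singletons, so the cover spends
  \<open>card W / 2 + card (S - W)\<close> of its \<open>j\<close> colors.\<close>

lemma clique_coverable_imp_pairable: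
  assumes "finite S" "triangle_free R S" "irreflp R" "clique_coverable R S j"
  obtains W where "W \<subseteq> S" "pairable R W" "2 * card S \<le> 2 * j + card W"
proof -
  obtain g :: "'a \<Rightarrow> nat" where g: "\<And>v. v \<in> S \<Longrightarrow> g v < j"
    and gR: "\<And>u v. u \<in> S \<Longrightarrow> v \<in> S \<Longrightarrow> u \<noteq> v \<Longrightarrow> g u = g v \<Longrightarrow> R u v"
    using assms(4) unfolding clique_coverable_def by blast
  define W where "W = {v \<in> S. \<exists>w\<in>S. w \<noteq> v \<and> g w = g v}"
  define f where "f v = (SOME w. w \<in> S \<and> w \<noteq> v \<and> g w = g v)" for v
  have f: "f v \<in> S \<and> f v \<noteq> v \<and> g (f v) = g v" if "v \<in> W" for v
    unfolding f_def by (rule someI_ex) (use that in \<open>auto simp: W_def\<close>)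
  have fW: "f v \<in> W" if "v \<in> W" for v
    using f[OF that] that unfolding W_def by (metis (mono_tags, lifting) mem_Collect_eq)
  \<comment> \<open>Two distinct classmates \<open>u\<close> and \<open>f v\<close> of
    \<open>v\<close> would form a triangle with \<open>v\<close>.\<close>
  have uniq: "u = f v" if "v \<in> W" "u \<in> S" "u \<noteq> v" "g u = g v" for u v
  proof (rule ccontr)
    assume "u \<noteq> f v"
    moreover have "v \<in> S" using that(1) by (simp add: W_def)
    ultimately have "R v u" "R u (f v)" "R v (f v)" using gR that f[OF that(1)] by auto
    then show False using assms(2) \<open>v \<in> S\<close> that(2) f[OF that(1)]
      unfolding triangle_free_def by blast
  qed
  have ff: "f (f v) = v" if "v \<in> W" for v
    using uniq[OF fW[OF that], of v] f[OF that] that by (auto simp: W_def)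
  have "R v (f v)" if "v \<in> W" for v
    using f[OF that] that by (intro gR) (auto simp: W_def)
  then have pair: "pairing R W f"
    unfolding pairing_def using fW ff by blast
  have W: "W \<subseteq> S" "finite W" using assms(1) by (auto simp: W_def)
  have "(\<lambda>v. {v, f v}) ` W = (\<lambda>c. {v \<in> S. g v = c}) ` g ` W"
  proof -
    have "{v, f v} = {u \<in> S. g u = g v}" if "v \<in> W" for v
      using uniq[OF that] f[OF that] that by (auto simp: W_def)
    then show ?thesis by (simp add: image_image)
  qed
  then have "card ((\<lambda>v. {v, f v}) ` W) \<le> card (g ` W)"
    using W(2) by (simp add: card_image_le)
  then have gW: "card W \<le> 2 * card (g ` W)"
    using card_pairing_edges[OF W(2) pair assms(3)] by linarith
  have "inj_on g (S - W)" by (rule inj_onI) (auto simp: W_def)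
  then have "card (g ` (S - W)) = card S - card W"
    using card_image card_Diff_subset[OF W(2,1)] by metis
  moreover have "g ` (S - W) \<inter> g ` W = {}" by (auto simp: W_def) metis
  then have "card (g ` (S - W) \<union> g ` W) = card (g ` (S - W)) + card (g ` W)"
    using assms(1) W(2) by (intro card_Un_disjoint) auto
  moreover have "card (g ` (S - W) \<union> g ` W) \<le> card {..<j}"
    using g W(1) by (intro card_mono) auto
  ultimately have "2 * card S \<le> 2 * j + card W"
    using gW card_mono[OF assms(1) W(1)] by simp
  then show ?thesis using that W(1) pair unfolding pairable_def by blast
qed

lemma card_clique_coverable_le:
  assumes "finite S" "triangle_free R S" "irreflp R" "clique_coverable R S j"
  shows "card S \<le> 2 * j"
  using clique_coverable_imp_pairable[OF assms] card_mono[OF assms(1)]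
  by (metis add_le_cancel_right le_trans mult_2 nat_add_left_cancel_le)

text \<open>A cover of a too small \<open>S\<close> uses a clique \<open>{t}\<close>; extend the union of the edges of the cover and
  \<open>t\<close> to a perfectly matchable set. Either this gives a larger covered set, or the new vertex lies
  in \<open>S\<close>, which saves a clique.\<close>

lemma card_maximal_clique_coverable:
  assumes "finite V" "card V = 2 * k + 1" "irreflp R" "symp R" "triangle_free R V"
    and dom: "\<And>v. v \<in> V \<Longrightarrow> \<exists>d\<in>V. pairable R (V - {d}) \<and> (v = d \<or> R d v)"
    and S: "S \<subseteq> V" "clique_coverable R S j" "j \<le> k"
    and max: "\<And>z. z \<in> V - S \<Longrightarrow> \<not> clique_coverable R (insert z S) j"
  shows "card S = 2 * j"
proof (rule ccontr)
  assume neq: "card S \<noteq> 2 * j"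
  have fin: "finite S" using S(1) assms(1) finite_subset by auto
  have tri: "triangle_free R S" using S(1) assms(5) unfolding triangle_free_def by blast
  have less: "card S < 2 * j"
    using card_clique_coverable_le[OF fin tri assms(3) S(2)] neq by simp
  obtain W where W: "W \<subseteq> S" "pairable R W" "2 * card S \<le> 2 * j + card W"
    using clique_coverable_imp_pairable[OF fin tri assms(3) S(2)] by blast
  have finW: "finite W" using W(1) fin finite_subset by auto
  \<comment> \<open>Such a \<open>W'\<close> would cover \<open>insert z S\<close> by
    \<open>j\<close> cliques, against maximality; the summand 2 accounts for the added
    vertex.\<close>
  have no_ext: False
    if "z \<in> V - S" "W' \<subseteq> insert z S" "pairable R W'" "2 * card S + 2 \<le> 2 * j + card W'" for z W'
    using max[OF that(1)] clique_coverable_if_pairable[of "insert z S" W' R j] that fin assms(3)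
    by simp
  \<comment> \<open>\<open>S\<close> is not all of \<open>V\<close>, as
    \<open>card S < 2 * j \<le> 2 * k < card V\<close>.\<close>
  obtain y where y: "y \<in> V - S"
    using less S(1,3) assms(2) by (metis Diff_eq_empty_iff all_not_in_conv card_mono fin
      le_add1 le_trans mult_le_mono2 not_le)
  show False
  proof (cases "S = W")
    case True
    obtain f where f: "pairing R W f" using W(2) unfolding pairable_def by blast
    \<comment> \<open>By parity \<open>S\<close> needs at most \<open>j - 1\<close> edges, which
      leaves a clique for \<open>{y}\<close>.\<close>
    have "even (card S)" using card_pairing_edges[OF finW f assms(3)] True by (metis dvd_triv_right)
    then have "card S + 2 \<le> 2 * j" using less by presburger
    then show False using no_ext[OF y, of W] W True by auto
  next
    case False
    then obtain t where t: "t \<in> S - W" using W(1) by blast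
    have "insert t W - {t} = W" using t by auto
    moreover have "insert t W \<subset> V" using t W(1) S(1) y by blast
    ultimately obtain z where z: "z \<in> V - insert t W" "pairable R (insert z (insert t W))"
      using pairable_extend[OF assms(1) _ _ _ assms(3,4) dom, of "insert t W" t] W(2) by auto
    have card: "card (insert z (insert t W)) = card W + 2" using z(1) t finW by simp
    show False
    proof (cases "z \<in> S")
      case True
      show False
        \<comment> \<open>The saved clique is spent on \<open>{y}\<close>.\<close>
        by (rule no_ext[OF y _ z(2)]) (use True t W(1,3) card in auto)
    next
      case False
      show False
        by (rule no_ext[of z, OF _ _ z(2)]) (use False z(1) t W(1,3) card in auto)
    qed
  qed
qed

text \<open>To reach \<open>x\<close> from \<open>c\<close>, let \<open>y\<close> be its partner: \<open>V - {x, y}\<close> is \<open>k\<close>-coverable, so one of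
  \<open>V - {x}\<close> and \<open>V - {y}\<close> has a perfect matching, whose symmetric difference with the given one
  contains an alternating path from \<open>c\<close> through \<open>x\<close>.\<close>

lemma alternating_paths_if_extendable:
  assumes "finite V" "card V = 2 * k + 1" "k \<ge> 1" "irreflp R" "symp R"
    and ext: "\<And>j S. 1 \<le> j \<Longrightarrow> j \<le> k \<Longrightarrow> S \<subseteq> V \<Longrightarrow> clique_coverable R S j \<Longrightarrow>
      \<exists>S'. S \<subseteq> S' \<and> S' \<subseteq> V \<and> clique_coverable R S' j \<and> card S' = 2 * j"
  shows "triangle_free R V" "\<exists>c\<in>V. \<exists>f. pairing R (V - {c}) f \<and> (\<exists>s\<in>V. R c s) \<and>
    (\<forall>x\<in>V - {c}. \<exists>p. alternating R f c V p \<and> x \<in> set p)"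
proof -
  show tri: "triangle_free R V"
    unfolding triangle_free_def
  proof (intro ballI notI)
    fix u v w assume V: "u \<in> V" "v \<in> V" "w \<in> V" and "R u v \<and> R v w \<and> R u w"
    then have R: "R u v" "R v w" "R u w" "R v u" "R w v" "R w u" using assms(5) by (auto dest: sympD)
    then have ne: "u \<noteq> v" "v \<noteq> w" "u \<noteq> w" using assms(4) by (auto dest: irreflpD)
    \<comment> \<open>A triangle is one clique, but the set of size 2 that \<open>ext\<close>
      provides for \<open>j = 1\<close> cannot contain it.\<close>
    have "clique_coverable R {u, v, w} 1"
      unfolding clique_coverable_def using R by (intro exI[of _ "\<lambda>_. 0"]) auto
    then obtain S' where S': "{u, v, w} \<subseteq> S'" "S' \<subseteq> V" "card S' = 2"
      using ext[of 1 "{u, v, w}"] assms(3) V by auto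
    then have "card {u, v, w} \<le> 2" using card_mono assms(1) finite_subset by metis
    then show False using ne by simp
  qed
  \<comment> \<open>With \<open>2 * k\<close> vertices in \<open>k\<close> cliques, the count forces
    \<open>W\<close> to be all of \<open>S\<close>.\<close>
  have full: "pairable R S" if S: "S \<subseteq> V" "clique_coverable R S k" "card S = 2 * k" for S
  proof -
    have fin: "finite S" using S(1) assms(1) finite_subset by auto
    have "triangle_free R S" using S(1) tri unfolding triangle_free_def by blast
    then obtain W where W: "W \<subseteq> S" "pairable R W" "2 * card S \<le> 2 * k + card W"
      using clique_coverable_imp_pairable[OF fin _ assms(4) S(2)] by blast
    then have "W = S" using card_seteq[OF fin] S(3) by simp
    then show ?thesis using W(2) by simp
  qed
  have drop: "\<exists>c. c \<in> V \<and> S = V - {c}" if S: "S \<subseteq> V" "card S = 2 * k" for S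
  proof -
    have "card (V - S) = 1"
      using card_Diff_subset[OF finite_subset[OF S(1) assms(1)] S(1)] S(2) assms(2) by simp
    then obtain c where "V - S = {c}" by (rule card_1_singletonE)
    then show ?thesis using S(1) by blast
  qed
  \<comment> \<open>Extending the empty set yields a perfectly matchable set of \<open>2 * k\<close>
    vertices; \<open>c\<close> is the vertex left over.\<close>
  have "clique_coverable R {} k" unfolding clique_coverable_def by simp
  then obtain S where S: "S \<subseteq> V" "clique_coverable R S k" "card S = 2 * k"
    using ext[of k "{}"] assms(3) by auto
  then obtain c f where c: "c \<in> V" and f: "pairing R (V - {c}) f"
    using drop full unfolding pairable_def by metis
  have "\<exists>s\<in>V. R c s"
  proof -
    \<comment> \<open>Extending \<open>{c}\<close> for \<open>j = 1\<close> yields a clique of two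
      vertices, that is, an edge at \<open>c\<close>.\<close>
    have "clique_coverable R {c} 1"
      unfolding clique_coverable_def by (intro exI[of _ "\<lambda>_. 0"]) auto
    then obtain S' where S': "{c} \<subseteq> S'" "S' \<subseteq> V" "card S' = 2" and cov: "clique_coverable R S' 1"
      using ext[OF order_refl assms(3) _ \<open>clique_coverable R {c} 1\<close>] c by auto
    obtain g where g: "\<forall>v\<in>S'. g v < (1::nat)"
      "\<forall>u\<in>S'. \<forall>v\<in>S'. u \<noteq> v \<and> g u = g v \<longrightarrow> R u v"
      using cov unfolding clique_coverable_def by (elim exE conjE)
    have "S' \<noteq> {c}" using S'(3) by auto
    then obtain s where s: "s \<in> S'" "s \<noteq> c" using S'(1) by blast
    have "g s = g c" using g(1) s(1) S'(1) by simp
    then have "R c s" using g(2) s S'(1) by simp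
    then show ?thesis using s S'(2) by blast
  qed
  moreover have "\<exists>p. alternating R f c V p \<and> x \<in> set p" if x: "x \<in> V - {c}" for x
  proof -
    define y where "y = f x"
    have y: "y \<in> V - {c}" "f y = x" "y \<noteq> x"
      using f x assms(4) unfolding pairing_def irreflp_def y_def by metis+
    have "pairing R (V - {c} - {x, y}) f"
      by (rule pairing_Diff[OF f]) (use y y_def in auto)
    \<comment> \<open>The \<open>k - 1\<close> remaining edges of \<open>f\<close> and the singleton
      \<open>{c}\<close> are \<open>k\<close> cliques.\<close>
    then have "clique_coverable R (V - {x, y}) k"
    proof (intro clique_coverable_if_pairable[of _ "V - {c} - {x, y}"])
      have "card (V - {x, y}) = 2 * k - 1"
        using card_Diff_subset[of "{x, y}" V] x y assms(2) by auto
      moreover have "card (V - {c} - {x, y}) = 2 * k - 2"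
        using card_Diff_subset[of "{x, y}" "V - {c}"] x y assms(1,2) c by auto
      ultimately show "2 * card (V - {x, y}) \<le> 2 * k + card (V - {c} - {x, y})"
        using assms(3) by linarith
    qed (use assms in \<open>auto simp: pairable_def\<close>)
    then obtain S' where S': "V - {x, y} \<subseteq> S'" "S' \<subseteq> V" "clique_coverable R S' k" "card S' = 2 * k"
      using ext[OF assms(3) order_refl Diff_subset] by blast
    then obtain d where d: "d \<in> V" "S' = V - {d}" using drop by metis
    then have dxy: "d = x \<or> d = y" using S'(1) by blast
    obtain m where m: "pairing R (V - {d}) m"
      using full[OF S'(2,3,4)] d(2) unfolding pairable_def by blast
    obtain p where p: "alternating R f c V p" "last (c # p) = d \<or> m (last (c # p)) \<notin> V"
      using symmetric_difference_path[OF assms(1) order_refl c f m assms(4)] by metis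
    note props = alternating_props[OF p(1) f assms(4)]
    \<comment> \<open>As \<open>m\<close> never leads out of \<open>V\<close>, the path can only
      stop at \<open>d\<close>.\<close>
    have "last (c # p) \<in> V" using last_in_set[of "c # p"] props(1) c by auto
    then have "last (c # p) = d" using p(2) m unfolding pairing_def by blast
    then have "d \<in> set p" using dxy x y(1) by (metis Diff_iff last.simps last_in_set singletonI)
    \<comment> \<open>The path is closed under \<open>f\<close>, which swaps \<open>x\<close> and
      \<open>y\<close>, so it contains \<open>x\<close> even if \<open>d = y\<close>.\<close>
    then have "x \<in> set p" using dxy props(3)[of y] y(2) by auto
    then show ?thesis using p(1) by blast
  qed
  ultimately show "\<exists>c\<in>V. \<exists>f. pairing R (V - {c}) f \<and> (\<exists>s\<in>V. R c s) \<and>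
    (\<forall>x\<in>V - {c}. \<exists>p. alternating R f c V p \<and> x \<in> set p)"
    using c f by blast
qed

subsection \<open>Colorings of a graph and matchings of its complement\<close>

lemma complement_iff:
  "(u, v) \<in> parcs (complement G) \<longleftrightarrow> u \<in> verts G \<and> v \<in> verts G \<and> u \<noteq> v \<and> \<not> u \<rightarrow>\<^bsub>G\<^esub> v"
  "pverts (complement G) = verts G"
  unfolding complement_def by auto

text \<open>The instance of \<open>R\<close> through which the matching lemmas are applied to
  \<open>G\<close>.\<close>

abbreviation nonadjacent :: "('a, 'b) pre_digraph \<Rightarrow> 'a \<Rightarrow> 'a \<Rightarrow> bool" where
  "nonadjacent G u v \<equiv> u \<rightarrow>\<^bsub>with_proj (complement G)\<^esub> v"

lemma irreflp_nonadjacent: "irreflp (nonadjacent G)"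
  by (auto simp: irreflp_def complement_iff)

lemma symp_nonadjacent: "symmetric G \<Longrightarrow> symp (nonadjacent G)"
  by (auto simp: symp_def complement_iff dest: arcs_ends_symmetric)

lemma dominates_induce_subgraph [simp]:
  "u \<rightarrow>\<^bsub>G \<restriction> S\<^esub> v \<longleftrightarrow> u \<rightarrow>\<^bsub>G\<^esub> v \<and> u \<in> S \<and> v \<in> S"
  unfolding arcs_ends_conv induce_subgraph_def by auto

lemma dominates_del_vert [simp]:
  "u \<rightarrow>\<^bsub>pre_digraph.del_vert G c\<^esub> v \<longleftrightarrow> u \<rightarrow>\<^bsub>G\<^esub> v \<and> u \<noteq> c \<and> v \<noteq> c"
  unfolding arcs_ends_conv pre_digraph.del_vert_def by auto

context loopfree_digraph
begin

text \<open>Color classes are independent sets, hence cliques of the complement; absence of loops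
  gives the distinctness that a clique condition speaks of.\<close>

lemma colorable_induce_iff:
  assumes "S \<subseteq> verts G"
  shows "colorable (G \<restriction> S) j \<longleftrightarrow> clique_coverable (nonadjacent G) S j"
proof -
  have "(\<forall>u v. u \<rightarrow>\<^bsub>G \<restriction> S\<^esub> v \<longrightarrow> f u \<noteq> f v) \<longleftrightarrow>
      (\<forall>u\<in>S. \<forall>v\<in>S. u \<noteq> v \<and> f u = f v \<longrightarrow> nonadjacent G u v)" for f :: "'a \<Rightarrow> nat"
  proof (intro iffI allI impI ballI)
    fix u v assume "\<forall>u v. u \<rightarrow>\<^bsub>G \<restriction> S\<^esub> v \<longrightarrow> f u \<noteq> f v" "u \<in> S" "v \<in> S" "u \<noteq> v \<and> f u = f v"
    then show "nonadjacent G u v" using assms by (simp add: complement_iff subset_iff) blast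
  next
    fix u v assume *: "\<forall>u\<in>S. \<forall>v\<in>S. u \<noteq> v \<and> f u = f v \<longrightarrow> nonadjacent G u v" "u \<rightarrow>\<^bsub>G \<restriction> S\<^esub> v"
    then have "u \<noteq> v" using adj_not_same by auto
    then show "f u \<noteq> f v" using * by (auto simp: complement_iff)
  qed
  then show ?thesis unfolding colorable_def clique_coverable_def by simp
qed

lemma colorable_iff: "colorable G j \<longleftrightarrow> clique_coverable (nonadjacent G) (verts G) j"
proof -
  have "arcs_ends (G \<restriction> verts G) = arcs_ends G" by (auto dest: adj_in_verts)
  then have "colorable G j \<longleftrightarrow> colorable (G \<restriction> verts G) j" unfolding colorable_def by simp
  then show ?thesis using colorable_induce_iff[of "verts G"] by simp
qed

lemma maximal_colorable_iff:
  "maximal_colorable G j S \<longleftrightarrow> S \<subseteq> verts G \<and> clique_coverable (nonadjacent G) S j \<and>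
    (\<forall>S'. S \<subset> S' \<and> S' \<subseteq> verts G \<longrightarrow> \<not> clique_coverable (nonadjacent G) S' j)"
  unfolding maximal_colorable_def
  by (intro conj_cong all_cong arg_cong[of _ _ Not] colorable_induce_iff refl) simp_all

end

lemma (in fin_digraph) maximal_colorable_extend:
  assumes "S \<subseteq> verts G" "colorable (G \<restriction> S) j"
  obtains S' where "S \<subseteq> S'" "maximal_colorable G j S'"
proof -
  let ?A = "{T. T \<subseteq> verts G \<and> colorable (G \<restriction> T) j}"
  have "finite ?A" "S \<in> ?A" using assms by auto
  from finite_has_maximal2[OF this] obtain S' where
    "S' \<in> ?A" "S \<subseteq> S'" "\<forall>T\<in>?A. S' \<subseteq> T \<longrightarrow> S' = T" by blast
  then show ?thesis using that[of S'] unfolding maximal_colorable_def by blast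
qed

section \<open>Hue sequences and the chromatic number\<close>

lemma hue_number_eq:
  assumes "well_hued G" "j \<ge> 1" "maximal_colorable G j S"
  shows "hue_number G j = card S"
  unfolding hue_number_def
proof (rule the_equality)
  show "\<exists>S'. maximal_colorable G j S' \<and> card S' = card S" using assms(3) by blast
  show "n = card S" if "\<exists>S'. maximal_colorable G j S' \<and> card S' = n" for n
    using that assms unfolding well_hued_def by blast
qed

lemma colorable_mono: "colorable G i \<Longrightarrow> i \<le> j \<Longrightarrow> colorable G j"
  unfolding colorable_def using less_le_trans by blast

lemma (in digraph) colorable_card: "colorable G (card (verts G))"
  unfolding colorable_iff
proof (rule clique_coverable_if_pairable)
  show "pairable (nonadjacent G) {}" by (simp add: pairable_def pairing_def)
qed (simp_all only: finite_verts empty_subsetI irreflp_nonadjacent card.empty)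

lemma (in digraph) colorable_iff_chromatic_number_le:
  "colorable G j \<longleftrightarrow> chromatic_number G \<le> j"
proof
  show "colorable G j \<Longrightarrow> chromatic_number G \<le> j"
    unfolding chromatic_number_def by (rule Least_le)
  have "colorable G (chromatic_number G)"
    unfolding chromatic_number_def by (rule LeastI, rule colorable_card)
  then show "chromatic_number G \<le> j \<Longrightarrow> colorable G j" by (rule colorable_mono)
qed

text \<open>From the chromatic number on, the whole vertex set is colorable and absorbs every other
  set. So only smaller \<open>j\<close> impose conditions, and the last term of the hue sequence is
  the order.\<close>

lemma (in digraph) maximal_colorable_verts:
  assumes "chromatic_number G \<le> j"
  shows "maximal_colorable G j S \<longleftrightarrow> S = verts G"
proof -
  have "clique_coverable (nonadjacent G) (verts G) j"
    using assms colorable_iff colorable_iff_chromatic_number_le by blast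
  then show ?thesis unfolding maximal_colorable_iff by blast
qed

text \<open>The length of the list fixes the chromatic number and its last term the order; what
  remains is a condition on the sizes of maximal sets for each \<open>j \<le> k\<close>.\<close>

lemma (in digraph) well_hued_sequence_iff:
  "well_hued G \<and> hue_sequence G = map (\<lambda>j. 2 * j) [1..<Suc k] @ [2 * k + 1] \<longleftrightarrow>
    chromatic_number G = k + 1 \<and> card (verts G) = 2 * k + 1 \<and>
    (\<forall>j S. 1 \<le> j \<and> j \<le> k \<and> maximal_colorable G j S \<longrightarrow> card S = 2 * j)" (is "?L \<longleftrightarrow> ?R")
proof
  assume L: ?L
  then have "length (hue_sequence G) = k + 1" by (simp del: upt_Suc)
  then have chi: "chromatic_number G = k + 1" unfolding hue_sequence_def by (simp del: upt_Suc)
  have "map (hue_number G) [1..<Suc k] @ [hue_number G (k + 1)] =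
      map (\<lambda>j. 2 * j) [1..<Suc k] @ [2 * k + 1]"
    using L chi unfolding hue_sequence_def by simp
  then have hue: "\<forall>j\<in>set [1..<Suc k]. hue_number G j = 2 * j" "hue_number G (k + 1) = 2 * k + 1"
    unfolding append1_eq_conv map_eq_conv by blast+
  have "card (verts G) = 2 * k + 1"
    using hue_number_eq[of G "k + 1" "verts G"] L maximal_colorable_verts[of "k + 1"] chi hue(2)
    by simp
  moreover have "card S = 2 * j" if "1 \<le> j" "j \<le> k" "maximal_colorable G j S" for j S
    using hue_number_eq[of G j S] L that hue(1) by (simp del: upt_Suc)
  ultimately show ?R using chi by blast
next
  assume R: ?R
  have wh: "well_hued G"
    unfolding well_hued_def
  proof (intro allI impI)
    fix j S T assume j: "1 \<le> j" and ST: "maximal_colorable G j S \<and> maximal_colorable G j T"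
    show "card S = card T"
    proof (cases "j \<le> k")
      case True
      then show ?thesis using R j ST by metis
    next
      case False
      then show ?thesis using R ST maximal_colorable_verts[of j] by simp
    qed
  qed
  have "hue_number G j = 2 * j" if j: "j \<in> set [1..<Suc k]" for j
  proof -
    \<comment> \<open>The value of \<open>hue_number\<close> is read off a maximal set, here grown
      from the empty set.\<close>
    have "colorable (G \<restriction> {}) j" by (auto simp: colorable_def)
    then obtain S where "maximal_colorable G j S" using maximal_colorable_extend[of "{}"] by blast
    then show ?thesis using hue_number_eq[OF wh, of j S] R j by auto
  qed
  then have "map (hue_number G) [1..<Suc k] = map (\<lambda>j. 2 * j) [1..<Suc k]"
    unfolding map_eq_conv by blast
  moreover have "hue_number G (k + 1) = 2 * k + 1"
    using hue_number_eq[OF wh, of "k + 1" "verts G"] maximal_colorable_verts[of "k + 1"] R by simp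
  ultimately show ?L using wh R unfolding hue_sequence_def by simp
qed

subsection \<open>Alternating paths of the complement\<close>

lemma vwalk_arcs_nth: "Suc i < length p \<Longrightarrow> vwalk_arcs p ! i = (p ! i, p ! Suc i)"
  by (induction p arbitrary: i rule: vwalk_arcs.induct) (simp_all add: nth_Cons split: nat.split)

lemma length_vwalk_arcs: "length (vwalk_arcs p) = length p - 1"
  by (rule vwalk_length_simp[unfolded vwalk_length_def])

lemma length_path_edges: "length (path_edges p) = length p - 1"
  by (simp add: path_edges_def length_vwalk_arcs)

lemma path_edges_nth: "Suc i < length p \<Longrightarrow> path_edges p ! i = {p ! i, p ! Suc i}"
  by (simp add: path_edges_def length_vwalk_arcs vwalk_arcs_nth)

lemma set_vwalk_arcs_subset_iff:
  "set (vwalk_arcs p) \<subseteq> A \<longleftrightarrow> (\<forall>i. Suc i < length p \<longrightarrow> (p ! i, p ! Suc i) \<in> A)"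
proof -
  have "set (vwalk_arcs p) = {(p ! i, p ! Suc i) | i. Suc i < length p}"
    unfolding set_conv_nth length_vwalk_arcs using vwalk_arcs_nth[of _ p]
    by (auto simp: less_diff_conv) (metis less_diff_conv Suc_eq_plus1)
  then show ?thesis by auto
qed

text \<open>The first edge is in \<open>M\<close> and membership flips from each edge to the next,
  so by induction exactly the edges with even index are in \<open>M\<close>.\<close>

lemma alternating_path_iff:
  "alternating_path H M p \<and> path_edges p \<noteq> [] \<and> hd (path_edges p) \<in> M \<longleftrightarrow>
    2 \<le> length p \<and> distinct p \<and> set p \<subseteq> verts H \<and>
    (\<forall>i. Suc i < length p \<longrightarrow> p ! i \<rightarrow>\<^bsub>H\<^esub> p ! Suc i \<and> ({p ! i, p ! Suc i} \<in> M \<longleftrightarrow> even i))"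
    (is "?L \<longleftrightarrow> ?R")
proof -
  let ?e = "\<lambda>i. {p ! i, p ! Suc i}"
  have ne: "path_edges p \<noteq> [] \<longleftrightarrow> 2 \<le> length p"
    using length_path_edges[of p] by (auto simp flip: length_0_conv)
  have hd: "hd (path_edges p) = ?e 0" if "2 \<le> length p"
    using that ne path_edges_nth[of 0 p] by (simp add: hd_conv_nth)
  have succ: "successively Q (path_edges p) \<longleftrightarrow>
      (\<forall>i. Suc (Suc i) < length p \<longrightarrow> Q (?e i) (?e (Suc i)))" for Q
    unfolding successively_conv_nth length_path_edges
    by (auto simp: less_diff_conv path_edges_nth)
  have vpath: "vpath p H \<longleftrightarrow> set p \<subseteq> verts H \<and> p \<noteq> [] \<and> distinct p \<and>
      (\<forall>i. Suc i < length p \<longrightarrow> p ! i \<rightarrow>\<^bsub>H\<^esub> p ! Suc i)"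
    unfolding vpath_def vwalk_def set_vwalk_arcs_subset_iff by auto
  have edge: "?e i \<in> edges H" if "p ! i \<rightarrow>\<^bsub>H\<^esub> p ! Suc i" for i
    using that unfolding edges_def by auto
  show ?thesis
  proof
    assume L: ?L
    then have len: "2 \<le> length p" and adj: "\<And>i. Suc i < length p \<Longrightarrow> p ! i \<rightarrow>\<^bsub>H\<^esub> p ! Suc i"
      using ne vpath unfolding alternating_path_def by auto
    have "?e i \<in> M \<longleftrightarrow> even i" if "Suc i < length p" for i
      using that
    proof (induction i)
      case 0
      then show ?case using L hd[OF len] by simp
    next
      case (Suc i)
      moreover have "\<not> (?e i \<in> M \<and> ?e (Suc i) \<in> M) \<and>
          \<not> (?e i \<in> edges H - M \<and> ?e (Suc i) \<in> edges H - M)"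
        using L Suc.prems unfolding alternating_path_def succ by blast
      moreover have "?e i \<in> edges H" "?e (Suc i) \<in> edges H"
        using adj Suc.prems edge by auto
      ultimately show ?case by auto
    qed
    then show ?R using L len adj vpath unfolding alternating_path_def by blast
  next
    assume R: ?R
    then have "\<not> (?e i \<in> M \<and> ?e (Suc i) \<in> M) \<and>
        \<not> (?e i \<in> edges H - M \<and> ?e (Suc i) \<in> edges H - M)" if "Suc (Suc i) < length p" for i
      using that by auto
    moreover have "?e 0 \<in> M" "p \<noteq> []" using R by auto
    ultimately show ?L using R ne hd unfolding alternating_path_def succ vpath by simp
  qed
qed

text \<open>Vertices are appended in matched pairs, so in the list without \<open>c\<close> the
  matching edges have even index.\<close>

lemma alternating_nth:
  assumes "alternating R f c T p" "pairing R (T - {c}) f" "irreflp R"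
  shows "even (length p) \<and> (p \<noteq> [] \<longrightarrow> R c (hd p)) \<and>
    (\<forall>i. Suc i < length p \<longrightarrow> R (p ! i) (p ! Suc i) \<and> (p ! Suc i = f (p ! i) \<longleftrightarrow> even i))"
  using assms(1)
proof (induction rule: alternating.induct)
  case (snoc p w)
  note props = alternating_props[OF snoc.hyps(1) assms(2,3)]
  have w: "R w (f w)" using assms(2) snoc.hyps(3) unfolding pairing_def by auto
  have "R ((p @ [w, f w]) ! i) ((p @ [w, f w]) ! Suc i) \<and>
      ((p @ [w, f w]) ! Suc i = f ((p @ [w, f w]) ! i) \<longleftrightarrow> even i)"
    if i: "Suc i < length (p @ [w, f w])" for i
  proof -
    \<comment> \<open>The edge lies within \<open>p\<close>, or it links \<open>last p\<close> to
      \<open>w\<close> and is no matching edge since the partner of \<open>last p\<close> lies in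
      \<open>p\<close>, or it is the new matching edge.\<close>
    consider "Suc i < length p" | "Suc i = length p" | "i = length p" using i by fastforce
    then show ?thesis
    proof cases
      case 1
      then show ?thesis using snoc.IH by (simp add: nth_append)
    next
      case 2
      then have "p \<noteq> []" by auto
      moreover from this have "p ! i = last p" using 2 by (metis last_conv_nth diff_Suc_1)
      moreover have "w \<noteq> f (last p)" using props(3)[of "last p"] snoc.hyps(3) \<open>p \<noteq> []\<close> by auto
      moreover have "odd i" using snoc.IH 2 by (metis even_Suc)
      ultimately show ?thesis using 2 snoc.hyps(2) by (simp add: nth_append)
    next
      case 3
      then show ?thesis using w snoc.IH by (simp add: nth_append)
    qed
  qed
  moreover have "R c (hd (p @ [w, f w]))" using snoc.IH snoc.hyps(2) by (cases p) auto
  ultimately show ?case using snoc.IH by simp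
qed simp

text \<open>Converse passage from indexed paths to the inductive form. Only prefixes of even length
  end with a complete matched pair; the second claim supplies the edge to the vertex after such a
  prefix.\<close>

lemma alternating_take:
  assumes "distinct p" "set p \<subseteq> T - {c}" "p \<noteq> [] \<Longrightarrow> R c (hd p)"
    and "\<And>i. Suc i < length p \<Longrightarrow> R (p ! i) (p ! Suc i)"
    and "\<And>i. Suc i < length p \<Longrightarrow> even i \<Longrightarrow> p ! Suc i = f (p ! i)"
  shows "2 * n \<le> length p \<Longrightarrow> alternating R f c T (take (2 * n) p)"
    and "2 * n < length p \<Longrightarrow> R (last (c # take (2 * n) p)) (p ! (2 * n))"
proof -
  have adj: "R (last (c # take (2 * n) p)) (p ! (2 * n))" if n: "2 * n < length p" for n
  proof (cases n)
    case 0
    then show ?thesis using assms(3) n by (cases p) auto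
  next
    case (Suc m)
    then have "take (2 * n) p \<noteq> []" using n by auto
    then have "last (c # take (2 * n) p) = p ! (2 * n - 1)"
      using n Suc by (simp add: last_conv_nth)
    then show ?thesis using assms(4)[of "2 * n - 1"] n Suc by simp
  qed
  then show "2 * n < length p \<Longrightarrow> R (last (c # take (2 * n) p)) (p ! (2 * n))" .
  show "2 * n \<le> length p \<Longrightarrow> alternating R f c T (take (2 * n) p)"
  proof (induction n)
    case (Suc n)
    let ?w = "p ! (2 * n)"
    have "take (2 * Suc n) p = take (2 * n) p @ [?w, f ?w]"
      using Suc.prems assms(5)[of "2 * n"] by (simp add: take_Suc_conv_app_nth)
    moreover have "?w \<in> T - set (c # take (2 * n) p)"
    proof -
      have "?w \<in> set p" using Suc.prems by simp
      moreover have "?w \<notin> set (take (2 * n) p)"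
        using assms(1) Suc.prems by (auto simp: in_set_conv_nth nth_eq_iff_index_eq)
      ultimately show ?thesis using assms(2) by auto
    qed
    ultimately show ?case using Suc adj[of n] by (auto intro!: alternating.snoc)
  qed (simp add: alternating.Nil)
qed

subsection \<open>The characterization\<close>

text \<open>Covering and disjointness put each vertex in exactly one member of \<open>M\<close>;
  that member has two elements, and \<open>f\<close> picks the other one.\<close>

lemma perfect_matching_pairing:
  assumes "perfect_matching H M" "\<And>A. A \<in> M \<Longrightarrow> card A = 2" "symmetric H"
  obtains f where "pairing (dominates H) (verts H) f"
    "\<And>u v. u \<in> verts H \<Longrightarrow> {u, v} \<in> M \<longleftrightarrow> v = f u"
proof -
  have M: "M \<subseteq> edges H" "disjoint M" "\<Union> M = verts H"
    using assms(1) unfolding perfect_matching_def matching_def by auto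
  have ex: "\<exists>!v. {u, v} \<in> M" if u: "u \<in> verts H" for u
  proof -
    obtain A where A: "A \<in> M" "u \<in> A" using M(3) u by blast
    obtain v where v: "A = {u, v}"
      using assms(2)[OF A(1)] A(2) unfolding card_2_iff by (metis insertE insert_commute singletonD)
    have "w = v" if w: "{u, w} \<in> M" for w
    proof -
      have "{u, w} = A" using disjointD[OF M(2) w A(1)] A(2) by blast
      then show ?thesis using v by (auto simp: doubleton_eq_iff)
    qed
    then show ?thesis using A(1) v by blast
  qed
  define f where "f u = (THE v. {u, v} \<in> M)" for u
  have f: "{u, f u} \<in> M" if "u \<in> verts H" for u
    unfolding f_def by (rule theI') (rule ex[OF that])
  have iff: "{u, v} \<in> M \<longleftrightarrow> v = f u" if "u \<in> verts H" for u v
    using ex[OF that] f[OF that] by blast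
  have "f u \<in> verts H \<and> f (f u) = u \<and> u \<rightarrow>\<^bsub>H\<^esub> f u" if u: "u \<in> verts H" for u
  proof -
    have fu: "f u \<in> verts H" using f[OF u] M(3) by blast
    moreover have "f (f u) = u" using iff[OF fu, of u] f[OF u] by (simp add: insert_commute)
    moreover have "u \<rightarrow>\<^bsub>H\<^esub> f u"
    proof -
      have "{u, f u} \<in> edges H" using f[OF u] M(1) by blast
      then obtain a b where "{u, f u} = {a, b}" "a \<rightarrow>\<^bsub>H\<^esub> b" unfolding edges_def by auto
      then show ?thesis using arcs_ends_symmetric[OF assms(3)] by (auto simp: doubleton_eq_iff)
    qed
    ultimately show ?thesis by blast
  qed
  then have "pairing (dominates H) (verts H) f" unfolding pairing_def by blast
  then show ?thesis using that iff by blast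
qed

text \<open>A larger independent set contains three vertices that form a triangle of the
  complement.\<close>

lemma independence_number_eq_2:
  assumes "finite (verts G)" "independent_set G {u, v}" "u \<noteq> v"
    and tri: "triangle_free (nonadjacent G) (verts G)"
  shows "independence_number G = 2"
  unfolding independence_number_def
proof (rule Max_eqI)
  have "{S. independent_set G S} \<subseteq> Pow (verts G)" unfolding independent_set_def by blast
  then show "finite (card ` {S. independent_set G S})" using assms(1) finite_subset by blast
  show "2 \<in> card ` {S. independent_set G S}"
    using assms(2,3) by (intro image_eqI[of _ _ "{u, v}"]) auto
  fix n assume "n \<in> card ` {S. independent_set G S}"
  then obtain S where S: "independent_set G S" "n = card S" by blast
  show "n \<le> 2"
  proof (rule ccontr)
    assume "\<not> n \<le> 2"
    then have "3 \<le> card S" using S(2) by simp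
    then obtain T where T: "T \<subseteq> S" "card T = 3" by (metis obtain_subset_with_card_n)
    then obtain a b c where abc: "T = {a, b, c}" "a \<noteq> b" "b \<noteq> c" "a \<noteq> c"
      unfolding card_3_iff by blast
    then have "nonadjacent G a b" "nonadjacent G b c" "nonadjacent G a c"
      using S(1) T(1) unfolding independent_set_def by (auto simp: complement_iff)
    moreover have "a \<in> verts G" "b \<in> verts G" "c \<in> verts G"
      using S(1) T(1) abc(1) unfolding independent_set_def by auto
    ultimately show False using tri unfolding triangle_free_def by blast
  qed
qed

lemma (in loopfree_digraph) triangle_free_nonadjacent:
  assumes "finite (verts G)" "independence_number G \<le> 2" "symmetric G"
  shows "triangle_free (nonadjacent G) (verts G)"
  unfolding triangle_free_def
proof (intro ballI notI)
  fix u v w assume "nonadjacent G u v \<and> nonadjacent G v w \<and> nonadjacent G u w"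
  then have uvw: "u \<noteq> v" "v \<noteq> w" "u \<noteq> w" "{u, v, w} \<subseteq> verts G"
    "\<not> u \<rightarrow> v" "\<not> v \<rightarrow> w" "\<not> u \<rightarrow> w" by (auto simp: complement_iff)
  then have "\<not> v \<rightarrow> u" "\<not> w \<rightarrow> v" "\<not> w \<rightarrow> u"
    using arcs_ends_symmetric[OF assms(3)] by auto
  then have "independent_set G {u, v, w}"
    using uvw adj_not_same unfolding independent_set_def by auto
  moreover have "{S. independent_set G S} \<subseteq> Pow (verts G)" unfolding independent_set_def by blast
  then have "finite (card ` {S. independent_set G S})" using assms(1) finite_subset by blast
  ultimately have "card {u, v, w} \<le> independence_number G"
    unfolding independence_number_def by (intro Max_ge) auto
  then show False using uvw(1-3) assms(2) by simp
qed

text \<open>Supplies the partite sets of the multipartite graph: they are the orbits of the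
  involution.\<close>

lemma partition_on_pairing:
  assumes "finite W" "pairing R W f" "irreflp R"
  defines "P \<equiv> (\<lambda>v. {v, f v}) ` W"
  shows "partition_on W P" "2 * card P = card W" "\<And>A. A \<in> P \<Longrightarrow> card A = 2"
    "\<And>u v. u \<in> W \<Longrightarrow> {u, v} \<in> P \<longleftrightarrow> v = f u"
proof -
  have f: "f v \<in> W" "f (f v) = v" "f v \<noteq> v" if "v \<in> W" for v
    using assms(2,3) that unfolding pairing_def irreflp_def by metis+
  show "2 * card P = card W" using card_pairing_edges[OF assms(1-3)] by (simp add: P_def)
  show "card A = 2" if "A \<in> P" for A
    using that f(3) unfolding P_def by (auto simp: card_2_iff)
  show iff: "{u, v} \<in> P \<longleftrightarrow> v = f u" if "u \<in> W" for u v
    using that f unfolding P_def by (auto simp: doubleton_eq_iff)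
  show "partition_on W P"
  proof (rule partition_onI)
    show "\<Union> P = W" unfolding P_def using f(1) by auto
    show "disjnt A B" if AB: "A \<in> P" "B \<in> P" "A \<noteq> B" for A B
    proof (rule ccontr)
      assume "\<not> disjnt A B"
      then obtain x where x: "x \<in> A" "x \<in> B" unfolding disjnt_def by blast
      have "C = {x, f x}" if "C \<in> P" "x \<in> C" for C
        using that f(2) unfolding P_def by auto
      then show False using AB x by metis
    qed
  qed (auto simp: P_def)
qed

text \<open>No arc stays inside a part, so every arc joins two different parts. With
  \<open>tail\<close> and \<open>head\<close> fixed as the projections, the arcs of \<open>G\<close>
  are pairs and compatible with those of the multipartite graph.\<close>

lemma spanning_complete_multipartite:
  fixes G :: "('a, 'a \<times> 'a) pre_digraph"
  assumes "wf_digraph G" "tail G = fst" "head G = snd" "partition_on (verts G) P"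
    and "\<And>A u v. A \<in> P \<Longrightarrow> u \<in> A \<Longrightarrow> v \<in> A \<Longrightarrow> \<not> u \<rightarrow>\<^bsub>G\<^esub> v"
  shows "spanning G (with_proj (complete_multipartite P))"
proof -
  let ?K = "complete_multipartite P"
  have P: "\<Union> P = verts G" using assms(4) by (simp add: partition_on_def)
  have "wf_digraph (with_proj ?K)"
    by unfold_locales (auto simp: complete_multipartite_def)
  moreover have "arcs G \<subseteq> parcs ?K"
  proof
    fix e assume e: "e \<in> arcs G"
    obtain u v where uv: "e = (u, v)" by (cases e)
    have adj: "u \<rightarrow>\<^bsub>G\<^esub> v" using e uv assms(2,3) unfolding arcs_ends_conv by force
    then obtain A B where "A \<in> P" "B \<in> P" "u \<in> A" "v \<in> B"
      using P wf_digraph.adj_in_verts[OF assms(1)] by blast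
    moreover from this have "A \<noteq> B" using assms(5) adj by blast
    ultimately show "e \<in> parcs ?K" using uv unfolding complete_multipartite_def by auto
  qed
  ultimately show ?thesis
    unfolding spanning_def subgraph_def compatible_def
    using P assms(2,3) assms(1) by (simp add: complete_multipartite_def)
qed

text \<open>A path from \<open>c\<close>, listed without \<open>c\<close>, starts at a neighbor of
  \<open>c\<close>, hence in the set in question, and continues with the matching edge
  there.\<close>

lemma alternating_dominating_setI:
  assumes "verts H = V - {c}" "\<And>u v. u \<rightarrow>\<^bsub>H\<^esub> v \<longleftrightarrow> u \<in> V - {c} \<and> v \<in> V - {c} \<and> R u v"
    and "irreflp R" "pairing R (V - {c}) f" "perfect_matching H M"
    and "\<And>u v. u \<in> V - {c} \<Longrightarrow> {u, v} \<in> M \<longleftrightarrow> v = f u"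
    and "\<And>v. v \<in> V - {c} \<Longrightarrow> \<exists>p. alternating R f c V p \<and> v \<in> set p"
  shows "alternating_dominating_set H M {s \<in> V - {c}. R c s}"
proof -
  have "\<exists>p. alternating_path H M p \<and> v \<in> set p \<and> hd p \<in> {s \<in> V - {c}. R c s} \<and>
      path_edges p \<noteq> [] \<and> hd (path_edges p) \<in> M" if v: "v \<in> V - {c}" for v
  proof -
    obtain p where p: "alternating R f c V p" "v \<in> set p" using assms(7) v by blast
    note props = alternating_props[OF p(1) assms(4,3)]
    note nth = alternating_nth[OF p(1) assms(4,3)]
    have ne: "p \<noteq> []" using p(2) by auto
    then have hd: "hd p \<in> {s \<in> V - {c}. R c s}" using nth props(1) hd_in_set[OF ne] by blast
    have in_V: "p ! i \<in> V - {c}" if "i < length p" for i using props(1) nth_mem[OF that] by blast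
    have "2 \<le> length p" using nth ne by (cases p; cases "tl p") auto
    moreover have "p ! i \<rightarrow>\<^bsub>H\<^esub> p ! Suc i \<and> ({p ! i, p ! Suc i} \<in> M \<longleftrightarrow> even i)"
      if i: "Suc i < length p" for i
      unfolding assms(2) using assms(6)[OF in_V[of i]] in_V[of i] in_V[of "Suc i"] nth i by auto
    ultimately have "alternating_path H M p \<and> path_edges p \<noteq> [] \<and> hd (path_edges p) \<in> M"
      unfolding alternating_path_iff using props(1,2) assms(1) by simp
    then show ?thesis using p(2) hd by blast
  qed
  then show ?thesis
    unfolding alternating_dominating_set_def using assms(1,5) by auto
qed

text \<open>Prefixing a dominating path by \<open>c\<close> gives an alternating path from the
  uncovered vertex; shifting the matching along a prefix uncovers the wanted
  \<open>d\<close>.\<close>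

lemma alternating_dominating_setD:
  assumes "verts H = V - {c}" "\<And>u v. u \<rightarrow>\<^bsub>H\<^esub> v \<longleftrightarrow> u \<in> V - {c} \<and> v \<in> V - {c} \<and> R u v"
    and "irreflp R" "symp R" "pairing R (V - {c}) f" "c \<in> V"
    and "\<And>u v. u \<in> V - {c} \<Longrightarrow> {u, v} \<in> M \<longleftrightarrow> v = f u"
    and "alternating_dominating_set H M {s \<in> V - {c}. R c s}" "v \<in> V"
  shows "\<exists>d\<in>V. pairable R (V - {d}) \<and> (v = d \<or> R d v)"
proof (cases "v = c \<or> R c v")
  case True
  \<comment> \<open>Here \<open>d = c\<close>.\<close>
  then show ?thesis using assms(5,6) unfolding pairable_def by blast
next
  case False
  then have "v \<in> verts H" "v \<notin> {s \<in> V - {c}. R c s}" using assms(1,9) by auto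
  then obtain p where p: "alternating_path H M p \<and> path_edges p \<noteq> [] \<and> hd (path_edges p) \<in> M"
    "v \<in> set p" "R c (hd p)"
    using assms(8) unfolding alternating_dominating_set_def by blast
  then have path: "distinct p" "set p \<subseteq> V - {c}"
    "\<And>i. Suc i < length p \<Longrightarrow> R (p ! i) (p ! Suc i)"
    "\<And>i. Suc i < length p \<Longrightarrow> {p ! i, p ! Suc i} \<in> M \<longleftrightarrow> even i"
    unfolding alternating_path_iff assms(1,2) by blast+
  have f: "p ! Suc i = f (p ! i)" if i: "Suc i < length p" "even i" for i
  proof -
    have "p ! i \<in> V - {c}" using path(2) i(1) nth_mem[of i p] by (meson Suc_lessD subsetD)
    from assms(7)[OF this] show ?thesis using path(4) i by blast
  qed
  note alt = alternating_take[of p V c R f, OF path(1,2) p(3) path(3) f]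
  have last: "last (c # q) \<in> V \<and> pairable R (V - {last (c # q)})" if q: "alternating R f c V q" for q
  proof -
    have "last (c # q) \<in> set (c # q)" by (rule last_in_set) simp
    then have "last (c # q) \<in> V" using alternating_props(1)[OF q assms(5,3)] assms(6) by auto
    then show ?thesis
      using alternating_pairing[OF q assms(5,3,4,6)] unfolding pairable_def by blast
  qed
  obtain i where i: "i < length p" "p ! i = v" using p(2) by (auto simp: in_set_conv_nth)
  show ?thesis
  proof (cases "even i")
    case True
    then obtain n where n: "i = 2 * n" by blast
    \<comment> \<open>The prefix before \<open>v\<close> ends at a neighbor of \<open>v\<close>,
      which serves as \<open>d\<close>.\<close>
    then have "alternating R f c V (take (2 * n) p)" "R (last (c # take (2 * n) p)) v"
      using alt(1)[of n] alt(2)[of n] i by auto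
    then show ?thesis using last by blast
  next
    case False
    then obtain n where n: "i = 2 * n + 1" by (rule oddE)
    \<comment> \<open>The prefix up to \<open>v\<close> ends with a matching edge into
      \<open>v\<close>, so \<open>d = v\<close>.\<close>
    then have alt: "alternating R f c V (take (2 * Suc n) p)" using alt(1)[of "Suc n"] i by simp
    have "take (2 * Suc n) p = take i p @ [v]"
      using i n by (simp add: take_Suc_conv_app_nth)
    then have "last (c # take (2 * Suc n) p) = v" by simp
    then show ?thesis using last[OF alt] by metis
  qed
qed

theorem theorem5:
  fixes G :: "'a pair_pre_digraph" and k :: nat
  assumes "k \<ge> 1" and "pair_graph G" and "connected (with_proj G)"
  shows "well_hued (with_proj G) \<and>
         hue_sequence (with_proj G) = map (\<lambda>j. 2 * j) [1..<Suc k] @ [2 * k + 1] \<longleftrightarrow>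
    (\<exists>c\<in>pverts G. \<exists>P.
       let G1 = pre_digraph.del_vert (with_proj G) c;
           S = verts G1 - closed_neighborhood (with_proj G) c
       in card (verts G1) = 2 * k \<and>
          partition_on (verts G1) P \<and> card P = k \<and> (\<forall>A\<in>P. card A = 2) \<and>
          spanning G1 (with_proj (complete_multipartite P)) \<and>
          independence_number G1 = 2 \<and>
          S \<noteq> {} \<and>
          independent_set (with_proj (complement G1)) S \<and>
          alternating_dominating_set (with_proj (complement G1)) P S)"
    (is "_ \<longleftrightarrow> ?R")
proof -
  interpret pair_graph G by fact
  let ?V = "pverts G"
  let ?G1 = "pre_digraph.del_vert (with_proj G)"
  define R where "R = nonadjacent (with_proj G)"
  have R: "R u v \<longleftrightarrow> u \<in> ?V \<and> v \<in> ?V \<and> u \<noteq> v \<and> (u, v) \<notin> parcs G" for u v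
    by (simp add: R_def complement_iff)
  have irrefl: "irreflp R" and sym: "symp R"
    unfolding R_def by (rule irreflp_nonadjacent, rule symp_nonadjacent[OF sym_arcs])
  have verts_G1: "verts (?G1 c) = ?V - {c}" for c by (simp add: verts_del_vert)
  have R1: "nonadjacent (?G1 c) u v \<longleftrightarrow> u \<in> ?V - {c} \<and> v \<in> ?V - {c} \<and> R u v" for c u v
    unfolding with_proj_simps complement_iff verts_G1 unfolding dominates_del_vert with_proj_simps R
    by blast
  have verts_H: "verts (with_proj (complement (?G1 c))) = ?V - {c}" for c
    by (simp add: complement_iff verts_G1)
  \<comment> \<open>The set \<open>S\<close> of the theorem is thus the neighborhood of
    \<open>c\<close> in the complement of \<open>G\<close>.\<close>
  have S: "?V - {c} - closed_neighborhood (with_proj G) c = {s \<in> ?V - {c}. R c s}"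
    if "c \<in> ?V" for c
    unfolding R closed_neighborhood_def with_proj_simps using that by blast
  have R_iff: "?R \<longleftrightarrow> (\<exists>c\<in>?V. \<exists>P. card (?V - {c}) = 2 * k \<and> partition_on (?V - {c}) P \<and>
      card P = k \<and> (\<forall>A\<in>P. card A = 2) \<and>
      spanning (?G1 c) (with_proj (complete_multipartite P)) \<and>
      independence_number (?G1 c) = 2 \<and> {s \<in> ?V - {c}. R c s} \<noteq> {} \<and>
      independent_set (with_proj (complement (?G1 c))) {s \<in> ?V - {c}. R c s} \<and>
      alternating_dominating_set (with_proj (complement (?G1 c))) P {s \<in> ?V - {c}. R c s})"
    unfolding Let_def verts_G1 by (rule bex_cong[OF refl]) (simp only: S)
  have cov: "colorable (with_proj G \<restriction> S) j \<longleftrightarrow> clique_coverable R S j" if "S \<subseteq> ?V" for S j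
    using colorable_induce_iff[OF that] unfolding R_def .
  let ?Q = "chromatic_number (with_proj G) = k + 1 \<and> card ?V = 2 * k + 1 \<and>
    (\<forall>j S. 1 \<le> j \<and> j \<le> k \<and> maximal_colorable (with_proj G) j S \<longrightarrow> card S = 2 * j)"
  have "?Q \<longleftrightarrow> ?R"
  proof
    assume Q: ?Q
    have ext: "\<exists>S'. S \<subseteq> S' \<and> S' \<subseteq> ?V \<and> clique_coverable R S' j \<and> card S' = 2 * j"
      if S: "1 \<le> j" "j \<le> k" "S \<subseteq> ?V" "clique_coverable R S j" for j S
    proof -
      obtain S' where S': "S \<subseteq> S'" "maximal_colorable (with_proj G) j S'"
        using maximal_colorable_extend[OF S(3)] cov[OF S(3)] S(4) by blast
      have "card S' = 2 * j" using Q S(1,2) S'(2) by blast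
      moreover have "S' \<subseteq> ?V \<and> clique_coverable R S' j"
        using S'(2) unfolding maximal_colorable_iff R_def by blast
      ultimately show ?thesis using S'(1) by blast
    qed
    have card: "card ?V = 2 * k + 1" using Q by blast
    have *: "triangle_free R ?V" "\<exists>c\<in>?V. \<exists>f. pairing R (?V - {c}) f \<and> (\<exists>s\<in>?V. R c s) \<and>
        (\<forall>x\<in>?V - {c}. \<exists>p. alternating R f c ?V p \<and> x \<in> set p)"
      by (rule alternating_paths_if_extendable[OF pair_finite_verts card assms(1) irrefl sym],
          erule (3) ext)+
    obtain c f s where c: "c \<in> ?V" and f: "pairing R (?V - {c}) f" and s: "s \<in> ?V" "R c s"
      and paths: "\<And>v. v \<in> ?V - {c} \<Longrightarrow> \<exists>p. alternating R f c ?V p \<and> v \<in> set p"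
      using *(2) by metis
    let ?P = "(\<lambda>v. {v, f v}) ` (?V - {c})"
    let ?H = "with_proj (complement (?G1 c))"
    let ?S = "{s \<in> ?V - {c}. R c s}"
    have fin: "finite (?V - {c})" using pair_finite_verts by blast
    note P = partition_on_pairing[OF fin f irrefl]
    have card1: "card (?V - {c}) = 2 * k" using c card by simp
    have edge: "R v (f v)" "R (f v) v" if "v \<in> ?V - {c}" for v
      using f that sympD[OF sym] unfolding pairing_def by blast+
    have nonadj: "\<not> u \<rightarrow>\<^bsub>?G1 c\<^esub> v" if uv: "A \<in> ?P" "u \<in> A" "v \<in> A" for A u v
    proof -
      obtain x where "x \<in> ?V - {c}" "A = {x, f x}" using uv(1) by blast
      then have "u = v \<or> R u v" using uv(2,3) edge by blast
      then show ?thesis using R adj_not_same by auto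
    qed
    have span: "spanning (?G1 c) (with_proj (complete_multipartite ?P))"
      by (rule spanning_complete_multipartite[OF wf_digraph_del_vert _ _ _ nonadj])
        (simp_all add: verts_G1 tail_del_vert head_del_vert P(1))
    have indep: "independence_number (?G1 c) = 2"
    proof -
      have "?V - {c} \<noteq> {}"
        using card1 assms(1) by (metis card.empty mult_is_0 not_one_le_zero zero_neq_numeral)
      then obtain v where v: "v \<in> ?V - {c}" by blast
      show ?thesis
      proof (rule independence_number_eq_2)
        show "finite (verts (?G1 c))" using fin by (simp only: verts_G1)
        show "v \<noteq> f v" using irreflpD[OF irrefl] edge(1)[OF v] by metis
        have "f v \<in> ?V - {c}" using f v unfolding pairing_def by blast
        moreover have "{v, f v} \<in> ?P" using v by blast
        ultimately show "independent_set (?G1 c) {v, f v}"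
          unfolding independent_set_def verts_G1 using v nonadj[of "{v, f v}"] by blast
        show "triangle_free (nonadjacent (?G1 c)) (verts (?G1 c))"
          using *(1) unfolding triangle_free_def verts_G1 R1 by blast
      qed
    qed
    have "?P \<subseteq> edges ?H"
    proof
      fix A assume "A \<in> ?P"
      then obtain v where v: "v \<in> ?V - {c}" "A = {v, f v}" by blast
      then have "v \<rightarrow>\<^bsub>?H\<^esub> f v" using f unfolding pairing_def R1 by blast
      then show "A \<in> edges ?H" using v(2) unfolding edges_def by blast
    qed
    then have pm: "perfect_matching ?H ?P"
      using partition_onD1[OF P(1)] partition_onD2[OF P(1)]
      unfolding perfect_matching_def matching_def verts_H by metis
    have "?S \<noteq> {}" using s R by blast
    \<comment> \<open>Two adjacent vertices of \<open>?S\<close> would form a triangle with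
      \<open>c\<close>.\<close>
    moreover have "independent_set ?H ?S"
      using *(1) c unfolding independent_set_def verts_H R1 triangle_free_def by blast
    moreover have "alternating_dominating_set ?H ?P ?S"
      by (rule alternating_dominating_setI[OF verts_H R1 irrefl f pm P(4) paths])
    moreover have "card ?P = k" using P(2) card1 by simp
    ultimately show ?R
      unfolding R_iff using card1 P(1,3) span indep
      by (intro bexI[OF _ c] exI[of _ ?P] conjI ballI)
  next
    assume ?R
    then obtain c P where c: "c \<in> ?V"
      and card1: "card (?V - {c}) = 2 * k"
      and "\<forall>A\<in>P. card A = 2"
      and indep: "independence_number (?G1 c) = 2"
      and S_indep: "independent_set (with_proj (complement (?G1 c))) {s \<in> ?V - {c}. R c s}"
      and dom: "alternating_dominating_set (with_proj (complement (?G1 c))) P {s \<in> ?V - {c}. R c s}"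
      unfolding R_iff by (elim bexE exE conjE)
    then have P: "card A = 2" if "A \<in> P" for A using that by blast
    let ?H = "with_proj (complement (?G1 c))"
    have pm: "perfect_matching ?H P" using dom unfolding alternating_dominating_set_def by blast
    have "symmetric ?H" unfolding symmetric_def sym_def R1 using sympD[OF sym] by blast
    then obtain f where f_H: "pairing (dominates ?H) (?V - {c}) f"
      and P_iff: "\<And>u v. u \<in> ?V - {c} \<Longrightarrow> {u, v} \<in> P \<longleftrightarrow> v = f u"
      using perfect_matching_pairing[OF pm P] unfolding verts_H by blast
    have f: "pairing R (?V - {c}) f" using f_H unfolding pairing_def R1 by blast
    have card: "card ?V = 2 * k + 1"
      using card_Suc_Diff1[OF pair_finite_verts c] card1 by simp
    have "loopfree_digraph (?G1 c)"
      using wf_digraph_del_vert no_loops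
      by (auto simp: loopfree_digraph_def loopfree_digraph_axioms_def del_vert_simps)
    moreover have "symmetric (?G1 c)"
      using sym_arcs unfolding symmetric_def sym_def dominates_del_vert by blast
    ultimately have tri_G1: "triangle_free (nonadjacent (?G1 c)) (?V - {c})"
      using loopfree_digraph.triangle_free_nonadjacent[of "?G1 c"] indep pair_finite_verts
      unfolding verts_G1 by simp
    have tri: "triangle_free R ?V"
      unfolding triangle_free_def
    proof (intro ballI notI)
      fix u v w assume uvw: "u \<in> ?V" "v \<in> ?V" "w \<in> ?V" "R u v \<and> R v w \<and> R u w"
      \<comment> \<open>Independence of the neighborhood of \<open>c\<close> excludes triangles
        through \<open>c\<close>; the others would be independent triples of
        \<open>?G1 c\<close>.\<close>
      have no_edge: "\<not> R x y" if "R c x" "R c y" for x y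
        using S_indep that R unfolding independent_set_def R1 by blast
      show False
      proof (cases "c \<in> {u, v, w}")
        case True
        then show False using uvw(4) no_edge sympD[OF sym] by blast
      next
        case False
        then show False using tri_G1 uvw unfolding triangle_free_def R1 by blast
      qed
    qed
    have dom: "\<exists>d\<in>?V. pairable R (?V - {d}) \<and> (v = d \<or> R d v)" if "v \<in> ?V" for v
      by (rule alternating_dominating_setD[OF verts_H R1 irrefl sym f c P_iff dom that])
    have "card S = 2 * j" if S: "1 \<le> j" "j \<le> k" "maximal_colorable (with_proj G) j S" for j S
    proof -
      have max: "S \<subseteq> ?V" "clique_coverable R S j"
        "\<And>S'. S \<subset> S' \<Longrightarrow> S' \<subseteq> ?V \<Longrightarrow> \<not> clique_coverable R S' j"
        using S(3) unfolding maximal_colorable_iff R_def by blast+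
      have no_ext: "\<not> clique_coverable R (insert z S) j" if "z \<in> ?V - S" for z
        by (rule max(3)) (use that max(1) in auto)
      show ?thesis
        by (rule card_maximal_clique_coverable
            [OF pair_finite_verts card irrefl sym tri dom max(1,2) S(2) no_ext])
    qed
    moreover have "chromatic_number (with_proj G) = k + 1"
    proof -
      \<comment> \<open>The \<open>k\<close> matching edges and \<open>{c}\<close> are
        \<open>k + 1\<close> cliques, whereas \<open>k\<close> cliques cover at most
        \<open>2 * k\<close> vertices.\<close>
      have "clique_coverable R ?V (k + 1)"
        by (rule clique_coverable_if_pairable[of _ "?V - {c}"])
          (use f card card1 pair_finite_verts irrefl in \<open>auto simp: pairable_def\<close>)
      moreover have "\<not> clique_coverable R ?V k"
        using card_clique_coverable_le[OF pair_finite_verts tri irrefl, of k] card by auto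
      ultimately show ?thesis
        using colorable_iff[of "k + 1"] colorable_iff[of k]
          colorable_iff_chromatic_number_le[of "k + 1"] colorable_iff_chromatic_number_le[of k]
        unfolding R_def by linarith
    qed
    ultimately show ?Q using card by blast
  qed
  then show ?thesis using well_hued_sequence_iff[of k] by blast
qed

end
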